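(* Let $S$ be a finite set with $|S|=n\ge 1$. Let $D_{\mathrm{IO}}^S=(N,A)$ be the network with node set $N=\{(X,Y) : Y\subseteq X\subseteq S\}$, whose arc set $A$ consists of all pairs $((X,Y),(Z,T))\in N\times N$ such that $X\subseteq Z$, $Y\subseteq T$, and either ($|Z|=|X|+1$ and $|T|=|Y|$) or ($|Z|=|X|$ and $|T|=|Y|+1$), with source $s=(\varnothing,\varnothing)$ and sink $t=(S,S)$. Let $\pi:\mathbb{R}^A\to\mathbb{R}^{S\star S}$ be the linear map sending $\Phi\in\mathbb{R}^A$ to the point $x\in\mathbb{R}^{S\star S}$ given, for all $(i,j)\in S\star S$, by $$x_{(i,j)}:=\sum\{\Phi_a : a=((X,Y),(Z,T))\in A,\ i\in Y,\ j\in Z\setminus X\}.$$ Then $\pi$ maps the flow polytope $F(D_{\mathrm{IO}}^S)$ onto the interval order polytope $P_{\mathrm{IO}}^S$, i.e. $\pi(F(D_{\mathrm{IO}}^S))=P_{\mathrm{IO}}^S$. Thus, the canonical description of $F(D_{\mathrm{IO}}^S)$ is an extended formulation of $P_{\mathrm{IO}}^S$ of size $|A|=2\,n\,3^{n-1}$.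
   Context: Notation: $S\star S:=(S\times S)\setminus\{(i,i): i\in S\}$. Interval order polytope: a relation $R$ on $S$ is an interval order if there exist mappings $\ell,h:S\to\mathbb{R}$ such that for all $i,j\in S$, $\ell(i)\le h(i)$ and ($i\,R\,j\iff h(i)<\ell(j)$). Equivalently, $R$ is irreflexive and, for all $i,j,i',j'\in S$, ($i\,R\,j$ and $i'\,R\,j'$) implies ($i\,R\,j'$ or $i'\,R\,j$). For an irreflexive relation $R$ on $S$, its characteristic vector $x^R\in\mathbb{R}^{S\star S}$ has coordinates $(x^R)_{(i,j)}=1$ if $i\,R\,j$ and $0$ otherwise. $P_{\mathrm{IO}}^S$ is the convex hull of the vectors $x^R$, for $R$ ranging over all interval orders on $S$. Flow polytope: let $D=(N,A)$ be an acyclic network (directed graph) with node set $N$, arc set $A$, source $s$ and sink $t$. For a node $v$, $\delta^+(v)$ and $\delta^-(v)$ are the sets of arcs leaving and entering $v$; for $\Phi\in\mathbb{R}^A$ and $B\subseteq A$, $\Phi(B):=\sum_{a\in B}\Phi_a$. The flow polytope $F(D)\subseteq\mathbb{R}^A$ is the polytope whose vertices are the characteristic vectors (in $\{0,1\}^A$) of the arc sets of all directed $s$–$t$ paths in $D$. Its canonical description (a standard fact) is the linear system $$\Phi(\delta^+(v))-\Phi(\delta^-(v))=0\ \ (v\in N\setminus\{s,t\}),\qquad \Phi(\delta^+(s))-\Phi(\delta^-(s))=1,\qquad \Phi_a\ge 0\ \ (a\in A),$$ whose solution set is $F(D)$. Extended formulation: an extended formulation of a polytope $P$ is a linear description (finite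 system of linear equations and inequalities) of a polytope $Q$ such that some affine map sends $Q$ onto $P$. The size of a linear description is its number of inequalities (equations and variables are not counted); so the canonical description of $F(D)$ has size $|A|$. *)

theory Defs
  imports
    "HOL-Analysis.Polytope"
    "HOL-Library.Function_Algebras"
    "HOL-Library.Indicator_Function"
    "Graph_Theory.Arc_Walk"
begin

instantiation "fun" :: (type, real_vector) real_vector
begin

definition scaleR_fun :: "real \<Rightarrow> ('a \<Rightarrow> 'b) \<Rightarrow> 'a \<Rightarrow> 'b" where
  "scaleR_fun r f = (\<lambda>x. r *\<^sub>R f x)"

instance
  by standard (simp_all add: scaleR_fun_def fun_eq_iff scaleR_add_right scaleR_add_left)

end

text \<open>
  For a finite index set \<open>I\<close>, the space of real vectors indexed by \<open>I\<close> is represented by the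
  functions that vanish outside \<open>I\<close>. It is a subspace of the real vector space of all functions,
  so that the library notions of convex hull, polytope and linear map apply.
\<close>

definition coord_space :: "'i set \<Rightarrow> ('i \<Rightarrow> real) set" where
  "coord_space I = {x. \<forall>i. i \<notin> I \<longrightarrow> x i = 0}"

definition affine_map :: "'i set \<Rightarrow> 'j set \<Rightarrow> (('i \<Rightarrow> real) \<Rightarrow> 'j \<Rightarrow> real) \<Rightarrow> bool" where
  "affine_map I J f \<longleftrightarrow>
     f ` coord_space I \<subseteq> coord_space J \<and>
     (\<exists>g c. linear g \<and> (\<forall>x \<in> coord_space I. f x = g x + c))"

text \<open>
  A pair \<open>(c, b)\<close> stands for the constraint \<open>(\<Sum>i\<in>I. c i * x i) = b\<close> or
  \<open>(\<Sum>i\<in>I. c i * x i) \<ge> b\<close>, depending on the component in which it occurs.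
\<close>

record 'i linear_system =
  equations :: "(('i \<Rightarrow> real) \<times> real) set"
  inequalities :: "(('i \<Rightarrow> real) \<times> real) set"

definition solutions :: "'i set \<Rightarrow> 'i linear_system \<Rightarrow> ('i \<Rightarrow> real) set" where
  "solutions I L = {x \<in> coord_space I.
     (\<forall>(c, b) \<in> equations L. (\<Sum>i\<in>I. c i * x i) = b) \<and>
     (\<forall>(c, b) \<in> inequalities L. (\<Sum>i\<in>I. c i * x i) \<ge> b)}"

definition linear_description :: "'i set \<Rightarrow> 'i linear_system \<Rightarrow> ('i \<Rightarrow> real) set \<Rightarrow> bool" where
  "linear_description I L Q \<longleftrightarrow>
     finite (equations L) \<and> finite (inequalities L) \<and> solutions I L = Q"

definition description_size :: "'i linear_system \<Rightarrow> nat" where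
  "description_size L = card (inequalities L)"

definition extended_formulation ::
    "'i set \<Rightarrow> 'i linear_system \<Rightarrow> 'j set \<Rightarrow> ('j \<Rightarrow> real) set \<Rightarrow> bool" where
  "extended_formulation I L J P \<longleftrightarrow>
     (\<exists>Q f. polytope Q \<and> linear_description I L Q \<and> affine_map I J f \<and> f ` Q = P)"

text \<open>
  The following two notions are meant for finite acyclic networks, with \<open>s \<noteq> t\<close>. Distinct paths
  have distinct 0/1 characteristic vectors, and these are in convex position, so they are the
  vertices of their convex hull.
\<close>

definition flow_polytope :: "('v, 'e) pre_digraph \<Rightarrow> 'v \<Rightarrow> 'v \<Rightarrow> ('e \<Rightarrow> real) set" where
  "flow_polytope D s t = convex hull {indicat_real (set p) | p. pre_digraph.apath D s p t}"

definition net_outflow :: "('v, 'e) pre_digraph \<Rightarrow> 'v \<Rightarrow> 'e \<Rightarrow> real" where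
  "net_outflow D v = (\<lambda>a. indicat_real (out_arcs D v) a - indicat_real (in_arcs D v) a)"

definition flow_description :: "('v, 'e) pre_digraph \<Rightarrow> 'v \<Rightarrow> 'v \<Rightarrow> 'e linear_system" where
  "flow_description D s t =
     \<lparr> equations = insert (net_outflow D s, 1) ((\<lambda>v. (net_outflow D v, 0)) ` (verts D - {s, t})),
       inequalities = (\<lambda>a. (indicat_real {a}, 0)) ` arcs D \<rparr>"

definition off_diag :: "'a set \<Rightarrow> ('a \<times> 'a) set" where
  "off_diag S = S \<times> S - Id_on S"

definition interval_order :: "'a set \<Rightarrow> 'a rel \<Rightarrow> bool" where
  "interval_order S R \<longleftrightarrow> R \<subseteq> S \<times> S \<and>
     (\<exists>l h :: 'a \<Rightarrow> real. \<forall>i\<in>S. \<forall>j\<in>S. l i \<le> h i \<and> ((i, j) \<in> R \<longleftrightarrow> h i < l j))"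

text \<open>
  An interval order on \<open>S\<close> is contained in \<open>off_diag S\<close>, so its indicator function is its
  characteristic vector in \<open>coord_space (off_diag S)\<close>.
\<close>

lemma interval_order_off_diag: "interval_order S R \<Longrightarrow> R \<subseteq> off_diag S"
  by (fastforce simp: interval_order_def off_diag_def)

definition io_polytope :: "'a set \<Rightarrow> ('a \<times> 'a \<Rightarrow> real) set" where
  "io_polytope S = convex hull {indicat_real R | R. interval_order S R}"

type_synonym 'a io_node = "'a set \<times> 'a set"
type_synonym 'a io_arc = "'a io_node \<times> 'a io_node"

definition io_nodes :: "'a set \<Rightarrow> 'a io_node set" where
  "io_nodes S = {(X, Y). Y \<subseteq> X \<and> X \<subseteq> S}"

definition io_arcs :: "'a set \<Rightarrow> 'a io_arc set" where
  "io_arcs S = {((X, Y), (Z, T)). (X, Y) \<in> io_nodes S \<and> (Z, T) \<in> io_nodes S \<and>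
     X \<subseteq> Z \<and> Y \<subseteq> T \<and>
     (card Z = card X + 1 \<and> card T = card Y \<or> card Z = card X \<and> card T = card Y + 1)}"

definition io_network :: "'a set \<Rightarrow> ('a io_node, 'a io_arc) pre_digraph" where
  "io_network S = \<lparr> verts = io_nodes S, arcs = io_arcs S, tail = fst, head = snd \<rparr>"

definition io_proj :: "'a set \<Rightarrow> ('a io_arc \<Rightarrow> real) \<Rightarrow> 'a \<times> 'a \<Rightarrow> real" where
  "io_proj S \<Phi> = (\<lambda>(i, j).
     if (i, j) \<in> off_diag S
     then \<Sum>a \<in> {((X, Y), (Z, T)) \<in> io_arcs S. i \<in> Y \<and> j \<in> Z - X}. \<Phi> a
     else 0)"

lemma linear_io_proj: "linear (io_proj S)"
  by (rule linearI)
    (auto simp: io_proj_def scaleR_fun_def fun_eq_iff sum.distrib sum_distrib_left)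

end

theory Submission
  imports Defs
begin

text \<open>
  In an acyclic network every feasible flow is a nonnegative combination of path vectors: as long as
  some arc out of the source carries flow, follow arcs of positive flow to the sink and subtract the
  minimum along the path; each round kills an arc. The value of the flow is the sum of the
  coefficients, hence the canonical description is correct.

  Along a source--sink path of the interval order network, every \<open>i\<close> enters the first component
  at some time \<open>l i\<close> and the second component at some time \<open>h i\<close>, with \<open>l i \<le> h i\<close>. The
  projection of the path is the characteristic vector of the interval order given by these
  intervals. Conversely, scanning the endpoints of an interval representation from left to right,
  left endpoints first in case of a tie, yields a path that projects to the given order. As the
  projection is linear, the two convex hulls correspond.
\<close>

subsection \<open>Flow decomposition\<close>

text \<open>\<open>rank\<close> certifies acyclicity and serves as an induction measure. Since no
  arc enters \<open>s\<close> or leaves \<open>t\<close>, conservation at the other nodes suffices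
  to extend walks forwards and to propagate zero flow.\<close>

locale st_network = fin_digraph G for G :: "('v, 'e) pre_digraph" (structure) +
  fixes s t :: 'v and rank :: "'v \<Rightarrow> nat"
  assumes source: "s \<in> verts G" and sink: "t \<in> verts G" and source_neq_sink: "s \<noteq> t"
    and head_neq_source: "a \<in> arcs G \<Longrightarrow> head G a \<noteq> s"
    and tail_neq_sink: "a \<in> arcs G \<Longrightarrow> tail G a \<noteq> t"
    and rank_less: "a \<in> arcs G \<Longrightarrow> rank (tail G a) < rank (head G a)"
begin

text \<open>Kept as an inner product with \<open>net_outflow\<close> so that it matches the
  equations of \<open>flow_description\<close> literally.\<close>

definition outflow :: "'v \<Rightarrow> ('e \<Rightarrow> real) \<Rightarrow> real" where
  "outflow v \<Phi> = (\<Sum>a\<in>arcs G. net_outflow G v a * \<Phi> a)"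

lemma linear_outflow: "linear (outflow v)"
  by (rule linearI)
    (simp_all add: outflow_def scaleR_fun_def sum.distrib sum_distrib_left algebra_simps)

lemma outflow_eq: "outflow v \<Phi> = sum \<Phi> (out_arcs G v) - sum \<Phi> (in_arcs G v)"
proof -
  have "(\<Sum>a\<in>arcs G. indicat_real B a * \<Phi> a) = sum \<Phi> B" if "B \<subseteq> arcs G" for B
    using that by (intro sum.mono_neutral_cong_right) (auto simp: indicator_def)
  from this[of "out_arcs G v"] this[of "in_arcs G v"] show ?thesis
    by (simp add: outflow_def net_outflow_def left_diff_distrib sum_subtractf subset_iff)
qed

text \<open>The contributions of the single arcs telescope. Distinctness makes the indicator of the
  walk the sum of the indicators of its arcs.\<close>

lemma outflow_walk:
  assumes "awalk u p w" "distinct p"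
  shows "outflow v (indicat_real (set p)) = of_bool (v = u) - of_bool (v = w)"
  using assms
proof (induction p arbitrary: u)
  case Nil
  then show ?case
    by (simp add: awalk_Nil_iff outflow_def)
next
  case (Cons a p)
  then have a: "a \<in> arcs G" "tail G a = u" "awalk (head G a) p w" "a \<notin> set p" "distinct p"
    by (auto simp: awalk_Cons_iff)
  have "indicat_real (set (a # p)) = indicat_real {a} + indicat_real (set p)"
    using a by (auto simp: indicator_def fun_eq_iff)
  moreover have "outflow v (indicat_real {a}) = net_outflow G v a"
    using a by (simp add: outflow_def indicator_def if_distrib sum.If_cases cong: if_cong)
  ultimately have "outflow v (indicat_real (set (a # p))) =
      net_outflow G v a + outflow v (indicat_real (set p))"
    by (simp add: linear_add[OF linear_outflow])
  also have "net_outflow G v a = of_bool (v = u) - of_bool (v = head G a)"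
    using a by (auto simp: net_outflow_def indicator_def)
  finally show ?case
    using Cons.IH[OF a(3,5)] by simp
qed

text \<open>Positive inflow at an inner node forces a positive arc out of it; as ranks increase and
  are bounded, the walk can only stop at \<open>t\<close>.\<close>

lemma positive_walk_to_sink:
  assumes nonneg: "\<And>a. a \<in> arcs G \<Longrightarrow> 0 \<le> \<Phi> a"
    and conserved: "\<And>v. v \<in> verts G - {s, t} \<Longrightarrow> outflow v \<Phi> = 0"
    and "a \<in> arcs G" "0 < \<Phi> a"
  shows "\<exists>p. awalk (tail G a) p t \<and> (\<forall>b\<in>set p. 0 < \<Phi> b)"
proof -
  obtain N where N: "\<And>v. v \<in> verts G \<Longrightarrow> rank v \<le> N"
    using finite_verts by (metis finite_imageI finite_nat_set_iff_bounded_le imageI)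
  show ?thesis
    using assms(3,4)
  proof (induction "N - rank (tail G a)" arbitrary: a rule: less_induct)
    case less
    let ?v = "head G a"
    have walk: "awalk (tail G a) (a # p) t \<and> (\<forall>b\<in>set (a # p). 0 < \<Phi> b)"
      if "awalk ?v p t" "\<forall>b\<in>set p. 0 < \<Phi> b" for p
      using that less.prems by (auto simp: awalk_Cons_iff)
    show ?case
    proof (cases "?v = t")
      case True
      then show ?thesis
        using walk[of "[]"] sink awalk_Nil_iff by auto
    next
      case False
      have "\<Phi> a \<le> sum \<Phi> (in_arcs G ?v)"
        using less.prems nonneg by (intro member_le_sum) (auto simp: in_arcs_def)
      moreover have "outflow ?v \<Phi> = 0"
        using False less.prems head_neq_source by (intro conserved) auto
      ultimately have "0 < sum \<Phi> (out_arcs G ?v)"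
        using less.prems by (simp add: outflow_eq)
      then obtain b where b: "b \<in> arcs G" "tail G b = ?v" "0 < \<Phi> b"
        by (metis in_out_arcs_conv leD not_le sum_nonpos)
      have "N - rank (tail G b) < N - rank (tail G a)"
        using rank_less[OF less.prems(1)] N[of ?v] b less.prems by simp
      from less.hyps[OF this b(1,3)] obtain p where "awalk ?v p t" "\<forall>b\<in>set p. 0 < \<Phi> b"
        using b(2) by auto
      from walk[OF this] show ?thesis ..
    qed
  qed
qed

text \<open>By induction on rank, no flow enters the tail of \<open>a\<close>; conservation and
  nonnegativity then leave nothing on the arcs going out.\<close>

lemma zero_flow:
  assumes nonneg: "\<And>a. a \<in> arcs G \<Longrightarrow> 0 \<le> \<Phi> a"
    and conserved: "\<And>v. v \<in> verts G - {s, t} \<Longrightarrow> outflow v \<Phi> = 0"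
    and source_zero: "\<And>a. a \<in> arcs G \<Longrightarrow> tail G a = s \<Longrightarrow> \<Phi> a = 0"
    and "a \<in> arcs G"
  shows "\<Phi> a = 0"
  using assms(4)
proof (induction "rank (tail G a)" arbitrary: a rule: less_induct)
  case less
  show ?case
  proof (cases "tail G a = s")
    case False
    then have "outflow (tail G a) \<Phi> = 0"
      using less.prems tail_neq_sink by (intro conserved) auto
    moreover have "sum \<Phi> (in_arcs G (tail G a)) = 0"
      using less.hyps rank_less by (intro sum.neutral) force
    ultimately have "sum \<Phi> (out_arcs G (tail G a)) = 0"
      by (simp add: outflow_eq)
    then have "\<forall>b\<in>out_arcs G (tail G a). \<Phi> b = 0"
      using nonneg by (subst (asm) sum_nonneg_eq_0_iff) auto
    then show ?thesis
      using less.prems by simp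
  qed (use less.prems source_zero in simp)
qed

text \<open>Induction on the size of the support. The flow value is left arbitrary, since
  subtracting a path changes it.\<close>

lemma flow_decomposition:
  assumes "\<Phi> \<in> coord_space (arcs G)"
    and "\<And>a. a \<in> arcs G \<Longrightarrow> 0 \<le> \<Phi> a"
    and "\<And>v. v \<in> verts G - {s, t} \<Longrightarrow> outflow v \<Phi> = 0"
  shows "\<exists>w. (\<forall>p. 0 \<le> w p) \<and> \<Phi> = (\<Sum>p | apath s p t. w p *\<^sub>R indicat_real (set p))"
  using assms
proof (induction "card {a \<in> arcs G. \<Phi> a \<noteq> 0}" arbitrary: \<Phi> rule: less_induct)
  case less
  show ?case
  proof (cases "\<exists>a\<in>arcs G. tail G a = s \<and> \<Phi> a \<noteq> 0")
    case False
    then have "\<Phi> a = 0" for a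
      using zero_flow[of \<Phi> a] less.prems by (cases "a \<in> arcs G") (auto simp: coord_space_def)
    then have "\<Phi> = (\<Sum>p | apath s p t. 0 *\<^sub>R indicat_real (set p))"
      by (auto simp: fun_eq_iff)
    then show ?thesis
      by (intro exI[of _ "\<lambda>_. 0"]) simp
  next
    case True
    then obtain a where a: "a \<in> arcs G" "tail G a = s" "0 < \<Phi> a"
      using less.prems(2) by force
    obtain q where q: "awalk s q t" "\<forall>b\<in>set q. 0 < \<Phi> b"
      using positive_walk_to_sink[OF less.prems(2,3) a(1,3)] a by auto
    \<comment> \<open>Shortening to a simple path makes \<open>p\<close> an index of the sum and its
      arcs distinct, while keeping only positive arcs.\<close>
    define p where "p = awalk_to_apath q"
    have p: "apath s p t" and pos: "\<forall>b\<in>set p. 0 < \<Phi> b"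
      unfolding p_def using q apath_awalk_to_apath awalk_to_apath_subset by blast+
    have walk: "awalk s p t" and dist: "distinct p"
      using p by (auto simp: apath_def intro: distinct_verts_imp_distinct)
    then have "set p \<subseteq> arcs G" "p \<noteq> []"
      using source_neq_sink by (auto simp: awalk_def)
    \<comment> \<open>The bottleneck value: subtracting it keeps the flow nonnegative and removes an
      arc attaining it from the support.\<close>
    define m where "m = Min (\<Phi> ` set p)"
    have m: "m \<in> \<Phi> ` set p" "\<And>b. b \<in> set p \<Longrightarrow> m \<le> \<Phi> b"
      unfolding m_def using \<open>p \<noteq> []\<close> by (auto intro: Min_in)
    then have "0 < m"
      using pos by auto
    define \<Psi> where "\<Psi> = \<Phi> - m *\<^sub>R indicat_real (set p)"
    have \<Psi>: "\<Psi> b = (if b \<in> set p then \<Phi> b - m else \<Phi> b)" for b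
      by (simp add: \<Psi>_def scaleR_fun_def)
    have "{b \<in> arcs G. \<Psi> b \<noteq> 0} \<subset> {b \<in> arcs G. \<Phi> b \<noteq> 0}"
      using m(1) pos \<open>set p \<subseteq> arcs G\<close> by (auto simp: \<Psi> split: if_splits) fastforce
    then have "card {b \<in> arcs G. \<Psi> b \<noteq> 0} < card {b \<in> arcs G. \<Phi> b \<noteq> 0}"
      by (intro psubset_card_mono) auto
    moreover have "\<Psi> \<in> coord_space (arcs G)"
      using less.prems(1) \<open>set p \<subseteq> arcs G\<close> by (auto simp: coord_space_def \<Psi>)
    moreover have "0 \<le> \<Psi> b" if "b \<in> arcs G" for b
      using that m(2) less.prems(2) by (simp add: \<Psi>)
    moreover have "outflow v \<Psi> = 0" if "v \<in> verts G - {s, t}" for v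
      using that less.prems(3) outflow_walk[OF walk dist]
      by (simp add: \<Psi>_def linear_diff[OF linear_outflow] linear_scale[OF linear_outflow])
    ultimately obtain w where w: "\<forall>p. 0 \<le> w p"
      "\<Psi> = (\<Sum>p | apath s p t. w p *\<^sub>R indicat_real (set p))"
      using less.hyps[of \<Psi>] by blast
    have "\<Phi> = m *\<^sub>R indicat_real (set p) + \<Psi>"
      by (simp add: \<Psi>_def)
    \<comment> \<open>The path \<open>p\<close> may already carry weight in the decomposition of
      \<open>\<Psi>\<close>, so \<open>m\<close> is added to \<open>w p\<close>. The set removes the
      fixed \<open>p\<close>; the summand's \<open>p\<close> is bound.\<close>
    also have "\<dots> = (w p + m) *\<^sub>R indicat_real (set p) +
        (\<Sum>p \<in> {p. apath s p t} - {p}. w p *\<^sub>R indicat_real (set p))"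
      unfolding w(2) using p
      by (subst sum.remove[of _ p]) (auto simp: apaths_finite scaleR_add_left)
    also have "\<dots> = (\<Sum>q | apath s q t. (w(p := w p + m)) q *\<^sub>R indicat_real (set q))"
      using p by (subst sum.remove[of _ p]) (auto simp: apaths_finite)
    finally show ?thesis
      using w(1) \<open>0 < m\<close> by (intro exI[of _ "w(p := w p + m)"]) (auto simp: add_nonneg_nonneg)
  qed
qed

section \<open>Correctness of the canonical description\<close>

lemma solutions_flow_description:
  "solutions (arcs G) (flow_description G s t) =
    {\<Phi> \<in> coord_space (arcs G). (\<forall>a\<in>arcs G. 0 \<le> \<Phi> a) \<and>
      (\<forall>v\<in>verts G - {s, t}. outflow v \<Phi> = 0) \<and> outflow s \<Phi> = 1}"
proof -
  have "(\<Sum>b\<in>arcs G. indicat_real {a} b * \<Phi> b) = \<Phi> a" if "a \<in> arcs G" for a and \<Phi> :: "'e \<Rightarrow> real"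
    using that by (simp add: indicator_def if_distrib sum.If_cases cong: if_cong)
  then show ?thesis
    by (auto simp: solutions_def flow_description_def outflow_def)
qed

lemma polytope_flow_polytope: "polytope (flow_polytope G s t)"
  using apaths_finite[of s t] unfolding polytope_def flow_polytope_def
  by (intro exI[of _ "{indicat_real (set p) | p. apath s p t}"]) simp

lemma flow_polytope_subset_solutions:
  "flow_polytope G s t \<subseteq> solutions (arcs G) (flow_description G s t)"
  unfolding flow_polytope_def
proof (rule hull_minimal)
  show "{indicat_real (set p) | p. apath s p t} \<subseteq> solutions (arcs G) (flow_description G s t)"
  proof clarify
    fix p assume "apath s p t"
    then have "awalk s p t" "distinct p"
      by (auto simp: apath_def intro: distinct_verts_imp_distinct)
    then show "indicat_real (set p) \<in> solutions (arcs G) (flow_description G s t)"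
      using source_neq_sink
      by (auto simp: solutions_flow_description outflow_walk coord_space_def awalk_def indicator_def)
  qed
  show "convex (solutions (arcs G) (flow_description G s t))"
    by (rule convexI)
      (simp add: solutions_flow_description coord_space_def linear_add[OF linear_outflow]
        linear_scale[OF linear_outflow], simp add: scaleR_fun_def)
qed

text \<open>Every path has outflow 1 at \<open>s\<close>, so the weights of the decomposition sum to
  the flow value 1 and form a convex combination.\<close>

lemma solutions_subset_flow_polytope:
  "solutions (arcs G) (flow_description G s t) \<subseteq> flow_polytope G s t"
proof
  fix \<Phi> assume \<Phi>: "\<Phi> \<in> solutions (arcs G) (flow_description G s t)"
  then obtain w where w: "\<forall>p. 0 \<le> w p"
    "\<Phi> = (\<Sum>p | apath s p t. w p *\<^sub>R indicat_real (set p))"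
    using flow_decomposition[of \<Phi>] by (auto simp: solutions_flow_description)
  have "1 = outflow s \<Phi>"
    using \<Phi> by (simp add: solutions_flow_description)
  also have "\<dots> = (\<Sum>p | apath s p t. w p * outflow s (indicat_real (set p)))"
    unfolding w(2) by (simp add: linear_sum[OF linear_outflow] linear_scale[OF linear_outflow])
  also have "\<dots> = (\<Sum>p | apath s p t. w p)"
  proof (rule sum.cong)
    fix p assume "p \<in> {p. apath s p t}"
    then have "awalk s p t" "distinct p"
      by (auto simp: apath_def intro: distinct_verts_imp_distinct)
    then show "w p * outflow s (indicat_real (set p)) = w p"
      using source_neq_sink by (simp add: outflow_walk)
  qed simp
  finally have "(\<Sum>p | apath s p t. w p) = 1" ..
  then show "\<Phi> \<in> flow_polytope G s t"
    unfolding flow_polytope_def w(2) using w(1)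
    by (intro convex_sum) (auto intro: hull_inc simp: apaths_finite)
qed

lemma linear_description_flow_polytope:
  "linear_description (arcs G) (flow_description G s t) (flow_polytope G s t)"
  unfolding linear_description_def
  using subset_antisym[OF solutions_subset_flow_polytope flow_polytope_subset_solutions]
  by (simp add: flow_description_def)

end

subsection \<open>The network of pairs of nested subsets\<close>

lemma finite_io_nodes: "finite S \<Longrightarrow> finite (io_nodes S)"
  by (rule finite_subset[of _ "Pow S \<times> Pow S"]) (auto simp: io_nodes_def)

lemma finite_io_arcs: "finite S \<Longrightarrow> finite (io_arcs S)"
  by (rule finite_subset[of _ "io_nodes S \<times> io_nodes S"])
    (auto simp: io_arcs_def intro: finite_io_nodes)

text \<open>For finite sets, inclusion with equal cardinality is equality, and inclusion with
  cardinality one larger is insertion of one element.\<close>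

lemma mem_io_arcs_iff:
  assumes "finite S"
  shows "((X, Y), (Z, T)) \<in> io_arcs S \<longleftrightarrow> Y \<subseteq> X \<and> X \<subseteq> S \<and>
    ((\<exists>j\<in>S - X. Z = insert j X \<and> T = Y) \<or> (\<exists>i\<in>X - Y. Z = X \<and> T = insert i Y))"
    (is "?lhs \<longleftrightarrow> ?rhs")
proof
  have ins: "\<exists>x\<in>B - A. B = insert x A" if "A \<subseteq> B" "finite B" "card B = card A + 1" for A B :: "'a set"
  proof -
    have "card (B - A) = 1"
      using that by (simp add: card_Diff_subset finite_subset)
    then obtain x where "B - A = {x}"
      by (auto simp: card_1_singleton_iff)
    then show ?thesis
      using that(1) by auto
  qed
  assume ?lhs
  then have sub: "Y \<subseteq> X" "X \<subseteq> S" "T \<subseteq> Z" "Z \<subseteq> S" "X \<subseteq> Z" "Y \<subseteq> T"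
    and card: "card Z = card X + 1 \<and> card T = card Y \<or> card Z = card X \<and> card T = card Y + 1"
    by (auto simp: io_arcs_def io_nodes_def)
  have fin: "finite Z" "finite T"
    using sub assms by (meson finite_subset)+
  from card show ?rhs
  proof
    assume "card Z = card X + 1 \<and> card T = card Y"
    then show ?rhs
      using ins[OF sub(5) fin(1)] card_subset_eq[OF fin(2) sub(6)] sub by auto
  next
    assume "card Z = card X \<and> card T = card Y + 1"
    then show ?rhs
      using ins[OF sub(6) fin(2)] card_subset_eq[OF fin(1) sub(5)] sub by auto
  qed
next
  assume rhs: ?rhs
  then have "finite X" "finite Y"
    using assms by (meson finite_subset)+
  with rhs show ?lhs
    by (auto simp: io_arcs_def io_nodes_def)
qed

text \<open>Each element has three states: outside \<open>X\<close>, in \<open>X - Y\<close>, or in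
  \<open>Y\<close>.\<close>

lemma card_io_nodes: "finite S \<Longrightarrow> card (io_nodes S) = 3 ^ card S"
proof (induction S rule: finite_induct)
  case empty
  have "io_nodes {} = {({} :: 'a set, {} :: 'a set)}"
    by (auto simp: io_nodes_def)
  then show ?case
    by simp
next
  case (insert x S)
  let ?N = "io_nodes S"
  \<comment> \<open>\<open>?N\<close> itself covers the pairs avoiding \<open>x\<close>,
    \<open>?f\<close> those with \<open>x\<close> in the first component only, \<open>?g\<close>
    those with \<open>x\<close> in both.\<close>
  let ?f = "\<lambda>(X, Y). (insert x X, Y)" and ?g = "\<lambda>(X, Y). (insert x X, insert x Y)"
  have x: "x \<notin> X" "x \<notin> Y" if "(X, Y) \<in> ?N" for X Y
    using that insert.hyps by (auto simp: io_nodes_def)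
  have inj: "inj_on ?f ?N" "inj_on ?g ?N"
    by (rule inj_on_inverseI[where g = "\<lambda>(X, Y). (X - {x}, Y - {x})"]; auto dest: x)+
  have disj: "?N \<inter> ?f ` ?N = {}" "(?N \<union> ?f ` ?N) \<inter> ?g ` ?N = {}"
    by (auto dest: x)
  have "io_nodes (insert x S) = ?N \<union> ?f ` ?N \<union> ?g ` ?N"
  proof (rule set_eqI, clarify)
    fix X Y
    have "(X, Y) \<in> ?N \<union> ?f ` ?N \<union> ?g ` ?N" if *: "(X, Y) \<in> io_nodes (insert x S)"
    proof (cases "x \<in> X")
      case False
      then show ?thesis
        using * by (auto simp: io_nodes_def)
    next
      case True
      then have "(X, Y) = (if x \<in> Y then ?g else ?f) (X - {x}, Y - {x})"
        using * by (auto simp: io_nodes_def)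
      moreover have "(X - {x}, Y - {x}) \<in> ?N"
        using * by (auto simp: io_nodes_def)
      ultimately show ?thesis
        by (cases "x \<in> Y") (simp_all only: if_True if_False UnI1 UnI2 image_eqI)
    qed
    then show "(X, Y) \<in> io_nodes (insert x S) \<longleftrightarrow> (X, Y) \<in> ?N \<union> ?f ` ?N \<union> ?g ` ?N"
      by (auto simp: io_nodes_def)
  qed
  then show ?case
    using insert inj disj by (simp add: card_Un_disjoint card_image finite_io_nodes)
qed

text \<open>An arc is determined by its kind, the element \<open>x\<close> it moves, and the states
  of the other elements, which form a node over \<open>S - {x}\<close>.\<close>

lemma card_io_arcs:
  assumes "finite S"
  shows "card (io_arcs S) = 2 * card S * 3 ^ (card S - 1)"
proof -
  define I where "I = (SIGMA x:S. io_nodes (S - {x}))"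
  define f where "f = (\<lambda>(x :: 'a, X, Y). ((X, Y), (insert x X, Y :: 'a set)))"
  define g where "g = (\<lambda>(x :: 'a, X, Y). ((insert x X, Y), (insert x X, insert x Y)))"
  have "finite I"
    using assms by (auto simp: I_def finite_io_nodes)
  have I: "x \<in> S \<and> x \<notin> X \<and> x \<notin> Y \<and> Y \<subseteq> X \<and> X \<subseteq> S" if "(x, X, Y) \<in> I" for x X Y
    using that by (auto simp: I_def io_nodes_def)
  have "inj_on f I"
    by (rule inj_on_inverseI[where g = "\<lambda>((X, Y), (Z, T)). (the_elem (Z - X), X, Y)"])
      (auto simp: f_def insert_Diff_if dest: I)
  moreover have "inj_on g I"
    \<comment> \<open>Here the moved element already lies in \<open>X\<close> and must be taken out
      to recover the node over \<open>S - {x}\<close>.\<close>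
    by (rule inj_on_inverseI[where g = "\<lambda>((X, Y), (Z, T)). (the_elem (T - Y), X - (T - Y), Y)"])
      (auto simp: g_def insert_Diff_if dest: I)
  moreover have "f ` I \<inter> g ` I = {}"
    by (auto simp: f_def g_def dest!: I)
  moreover have "io_arcs S = f ` I \<union> g ` I"
  proof (intro set_eqI iffI)
    fix a assume "a \<in> io_arcs S"
    then obtain X Y Z T where a: "a = ((X, Y), (Z, T))" "((X, Y), (Z, T)) \<in> io_arcs S"
      by (metis prod.collapse)
    then consider (add_X) j where "j \<in> S - X" "Z = insert j X" "T = Y" "Y \<subseteq> X" "X \<subseteq> S"
      | (add_Y) i where "i \<in> X - Y" "Z = X" "T = insert i Y" "Y \<subseteq> X" "X \<subseteq> S"
      by (auto simp: mem_io_arcs_iff[OF assms])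
    then show "a \<in> f ` I \<union> g ` I"
    proof cases
      case add_X
      then have "a = f (j, X, Y)" "(j, X, Y) \<in> I"
        by (auto simp: a f_def I_def io_nodes_def)
      then show ?thesis
        by blast
    next
      case add_Y
      then have "a = g (i, X - {i}, Y)" "(i, X - {i}, Y) \<in> I"
        by (auto simp: a g_def I_def io_nodes_def)
      then show ?thesis
        by blast
    qed
  next
    fix a assume "a \<in> f ` I \<union> g ` I"
    then obtain x X Y where x: "(x, X, Y) \<in> I" and a: "a = f (x, X, Y) \<or> a = g (x, X, Y)"
      by auto
    show "a \<in> io_arcs S"
      using I[OF x] a by (auto simp: f_def g_def mem_io_arcs_iff[OF assms])
  qed
  moreover have "card I = card S * 3 ^ (card S - 1)"
    using assms by (simp add: I_def card_SigmaI card_io_nodes finite_io_nodes)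
  ultimately show ?thesis
    using \<open>finite I\<close> by (simp add: card_Un_disjoint card_image)
qed

text \<open>Each arc adds one element to one component, so the sum of the two cardinalities is a
  rank.\<close>

lemma st_network_io_network:
  assumes "finite S" "S \<noteq> {}"
  shows "st_network (io_network S) ({}, {}) (S, S) (\<lambda>v. card (fst v) + card (snd v))"
proof
  fix a assume "a \<in> arcs (io_network S)"
  then have a: "a \<in> io_arcs S"
    by (simp add: io_network_def)
  then show "tail (io_network S) a \<in> verts (io_network S)"
    "head (io_network S) a \<in> verts (io_network S)"
    "card (fst (tail (io_network S) a)) + card (snd (tail (io_network S) a)) <
      card (fst (head (io_network S) a)) + card (snd (head (io_network S) a))"
    by (auto simp: io_network_def io_arcs_def)
  obtain X Y Z T where "a = ((X, Y), (Z, T))"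
    by (metis prod.collapse)
  with a show "head (io_network S) a \<noteq> ({}, {})" "tail (io_network S) a \<noteq> (S, S)"
    by (auto simp: io_network_def mem_io_arcs_iff[OF assms(1)])
qed (use assms in \<open>simp_all add: io_network_def finite_io_nodes finite_io_arcs,
    simp_all add: io_nodes_def\<close>)

subsection \<open>Paths and interval orders\<close>

definition path_relation :: "'a io_arc list \<Rightarrow> 'a rel" where
  "path_relation p = {(i, j). \<exists>a\<in>set p. i \<in> snd (fst a) \<and> j \<in> fst (snd a) - fst (fst a)}"

context
  fixes S :: "'a set"
  assumes finite: "finite S" and nonempty: "S \<noteq> {}"
begin

interpretation st_network "io_network S" "({}, {})" "(S, S)" "\<lambda>v. card (fst v) + card (snd v)"
  by (rule st_network_io_network[OF finite nonempty])

lemma io_network_simps [simp]: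
  "verts (io_network S) = io_nodes S" "arcs (io_network S) = io_arcs S"
  "tail (io_network S) = fst" "head (io_network S) = snd"
  by (simp_all add: io_network_def)

section \<open>Monotonicity along walks\<close>

lemma io_arc_mono:
  assumes "a \<in> io_arcs S"
  shows "fst (fst a) \<subseteq> fst (snd a)" "snd (fst a) \<subseteq> snd (snd a)" "snd (fst a) \<subseteq> fst (fst a)"
    "fst (snd a) \<subseteq> S"
  using assms by (auto simp: io_arcs_def io_nodes_def)

lemma io_walk_start_le:
  assumes "awalk u p w" "a \<in> set p"
  shows "fst u \<subseteq> fst (fst a) \<and> snd u \<subseteq> snd (fst a)"
  using assms
proof (induction p arbitrary: u)
  case (Cons b p)
  then have b: "b \<in> io_arcs S" "fst b = u" "awalk (snd b) p w"
    by (auto simp: awalk_Cons_iff)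
  show ?case
  proof (cases "a = b")
    case False
    then have "fst (snd b) \<subseteq> fst (fst a) \<and> snd (snd b) \<subseteq> snd (fst a)"
      using Cons.IH[OF b(3)] Cons.prems(2) by simp
    then show ?thesis
      using io_arc_mono(1,2)[OF b(1)] b(2) by auto
  qed (use b in simp)
qed simp

text \<open>Both components only grow, so the head of the earlier arc lies below the tail of the
  later one. This replaces reasoning about list positions.\<close>

lemma io_walk_arcs_linear:
  assumes "awalk u p w" "a \<in> set p" "b \<in> set p"
  shows "a = b \<or> fst (snd a) \<subseteq> fst (fst b) \<and> snd (snd a) \<subseteq> snd (fst b) \<or>
    fst (snd b) \<subseteq> fst (fst a) \<and> snd (snd b) \<subseteq> snd (fst a)"
  using assms
proof (induction p arbitrary: u)
  case (Cons c p)
  then have walk: "awalk (snd c) p w"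
    by (simp add: awalk_Cons_iff)
  consider "a = b" | "a = c" "b \<in> set p" | "b = c" "a \<in> set p" | "a \<in> set p" "b \<in> set p"
    using Cons.prems by auto
  then show ?case
  proof cases
    case 2
    then show ?thesis
      using io_walk_start_le[OF walk, of b] by blast
  next
    case 3
    then show ?thesis
      using io_walk_start_le[OF walk, of a] by blast
  next
    case 4
    then show ?thesis
      using Cons.IH[OF walk] by blast
  qed blast
qed simp

lemma io_walk_enters:
  assumes "awalk u p w" "j \<in> fst w" "j \<notin> fst u"
  shows "\<exists>a\<in>set p. j \<in> fst (snd a) - fst (fst a) \<and> snd u \<subseteq> snd (fst a)"
  using assms
proof (induction p arbitrary: u)
  case Nil
  then show ?case
    by (simp add: awalk_Nil_iff)
next
  case (Cons a p)
  then have a: "a \<in> io_arcs S" "fst a = u" "awalk (snd a) p w"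
    by (auto simp: awalk_Cons_iff)
  show ?case
  proof (cases "j \<in> fst (snd a)")
    case True
    then show ?thesis
      using a Cons.prems by auto
  next
    case False
    then show ?thesis
      using Cons.IH[OF a(3)] Cons.prems(2) io_arc_mono[OF a(1)] a(2) by fastforce
  qed
qed

text \<open>A coordinate counts the arcs of the path contributing to it, and there is at most one
  because \<open>j\<close> enters the first component only once.\<close>

lemma io_proj_path:
  assumes walk: "awalk u p w"
  shows "io_proj S (indicat_real (set p)) = indicat_real (path_relation p)"
proof (rule ext, clarify)
  fix i j
  have arcs: "set p \<subseteq> io_arcs S"
    using walk by (auto simp: awalk_def)
  have off_diag: "(i, j) \<in> off_diag S" if "(i, j) \<in> path_relation p"
  proof -
    from that obtain a where "a \<in> io_arcs S" "i \<in> snd (fst a)" "j \<in> fst (snd a) - fst (fst a)"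
      using arcs by (auto simp: path_relation_def)
    then show ?thesis
      using io_arc_mono[of a] by (auto simp: off_diag_def)
  qed
  define A where "A = {((X, Y), (Z, T)) \<in> io_arcs S. i \<in> Y \<and> j \<in> Z - X}"
  have A: "a \<in> A \<longleftrightarrow> a \<in> io_arcs S \<and> i \<in> snd (fst a) \<and> j \<in> fst (snd a) - fst (fst a)" for a
    by (auto simp: A_def split: prod.splits)
  have "finite A"
    by (rule finite_subset[OF _ finite_io_arcs[OF finite]]) (auto simp: A)
  then have sum: "sum (indicat_real (set p)) A = card (A \<inter> set p)"
    by (simp add: indicator_def sum.If_cases)
  have "card (A \<inter> set p) = of_bool ((i, j) \<in> path_relation p)"
  proof (cases "(i, j) \<in> path_relation p")
    case True
    then obtain a where a: "a \<in> A \<inter> set p"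
      using arcs by (auto simp: path_relation_def A)
    \<comment> \<open>Of two different arcs, the later one would already have \<open>j\<close> in
      the first component of its tail.\<close>
    have "b = a" if "b \<in> A \<inter> set p" for b
      using io_walk_arcs_linear[OF walk, of a b] a that by (auto simp: A)
    then have "A \<inter> set p = {a}"
      using a by blast
    then show ?thesis
      using True by simp
  next
    case False
    then have "A \<inter> set p = {}"
      using arcs by (auto simp: path_relation_def A)
    then show ?thesis
      using False by simp
  qed
  then show "io_proj S (indicat_real (set p)) (i, j) = indicat_real (path_relation p) (i, j)"
    using off_diag sum by (auto simp: io_proj_def A_def indicator_def)
qed

lemma interval_order_path_relation:
  assumes walk: "awalk ({}, {}) p (S, S)"
  shows "interval_order S (path_relation p)"
proof -
  have arcs: "set p \<subseteq> io_arcs S"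
    using walk by (auto simp: awalk_def)
  \<comment> \<open>The counts below are the positions on the path at which \<open>j\<close> enters the first component and
    \<open>i\<close> enters the second one.\<close>
  define L where "L j = {a \<in> set p. j \<notin> fst (fst a)}" for j
  define H where "H i = {a \<in> set p. i \<notin> snd (fst a)}" for i
  have fin: "finite (L j)" "finite (H i)" for i j
    by (auto simp: L_def H_def)
  have "L i \<subseteq> H i" for i
    using arcs io_arc_mono(3) unfolding L_def H_def by blast
  then have le: "real (card (L i)) \<le> real (card (H i))" for i
    using fin by (simp add: card_mono)
  have "(i, j) \<in> path_relation p \<longleftrightarrow> real (card (H i)) < real (card (L j))" if "j \<in> S" for i j
  proof
    assume "(i, j) \<in> path_relation p"
    then obtain a where a: "a \<in> set p" "i \<in> snd (fst a)" "j \<in> fst (snd a)" "j \<notin> fst (fst a)"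
      by (auto simp: path_relation_def)
    have "b \<in> L j" if "b \<in> H i" for b
    proof -
      have b: "b \<in> set p" "i \<notin> snd (fst b)"
        using that by (auto simp: H_def)
      then have "a \<in> io_arcs S" "b \<in> io_arcs S" "a \<noteq> b"
        using a arcs by auto
      \<comment> \<open>Only the tail of \<open>a\<close> has \<open>i\<close> in its second
        component, so \<open>b\<close> comes before \<open>a\<close>.\<close>
      then have "fst (fst b) \<subseteq> fst (fst a)"
        using io_walk_arcs_linear[OF walk a(1) b(1)] io_arc_mono[of a] io_arc_mono[of b] a(2) b(2)
        by blast
      then show ?thesis
        using a(4) b(1) by (auto simp: L_def)
    qed
    moreover have "a \<in> L j" "a \<notin> H i"
      using a by (auto simp: L_def H_def)
    ultimately have "H i \<subset> L j"
      by blast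
    then show "real (card (H i)) < real (card (L j))"
      using fin by (simp add: psubset_card_mono)
  next
    assume "real (card (H i)) < real (card (L j))"
    then have "\<not> L j \<subseteq> H i"
      using fin card_mono[of "H i" "L j"] by auto
    then obtain a where a: "a \<in> set p" "i \<in> snd (fst a)" "j \<notin> fst (fst a)"
      by (auto simp: L_def H_def)
    \<comment> \<open>At the tail of \<open>a\<close>, \<open>i\<close> has entered the second
      component and \<open>j\<close> has not entered the first; the rest of the walk must still
      bring \<open>j\<close> in.\<close>
    then obtain q r where "p = q @ a # r"
      by (meson split_list)
    then have "awalk (fst a) (a # r) (S, S)"
      using walk by (auto simp: awalk_Cons_iff)
    then obtain b where "b \<in> set (a # r)" "j \<in> fst (snd b) - fst (fst b)" "snd (fst a) \<subseteq> snd (fst b)"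
      using io_walk_enters a(3) \<open>j \<in> S\<close> by (metis fst_conv)
    then show "(i, j) \<in> path_relation p"
      using a(2) \<open>p = q @ a # r\<close> by (auto simp: path_relation_def)
  qed
  moreover have "path_relation p \<subseteq> S \<times> S"
  proof clarify
    fix i j assume "(i, j) \<in> path_relation p"
    then obtain a where "a \<in> io_arcs S" "i \<in> snd (fst a)" "j \<in> fst (snd a)"
      using arcs by (auto simp: path_relation_def)
    then show "i \<in> S \<and> j \<in> S"
      using io_arc_mono[of a] by blast
  qed
  ultimately show ?thesis
    unfolding interval_order_def using le
    by (intro conjI exI[of _ "\<lambda>i. real (card (L i))"] exI[of _ "\<lambda>i. real (card (H i))"]) auto
qed

section \<open>From an interval order to a path\<close>

text \<open>
  On a walk through compatible nodes, the elements of \<open>Y\<close> are already known to precede everything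
  outside \<open>X\<close>, and no element outside \<open>Y\<close> precedes an element of \<open>X\<close>, so the arc on which \<open>j\<close>
  enters \<open>X\<close> has exactly the predecessors of \<open>j\<close> in its \<open>Y\<close>.
\<close>

definition compatible_node :: "'a rel \<Rightarrow> 'a io_node \<Rightarrow> bool" where
  "compatible_node R v \<longleftrightarrow> v \<in> io_nodes S \<and>
     snd v \<times> (S - fst v) \<subseteq> R \<and> (S - snd v) \<times> fst v \<inter> R = {}"

text \<open>The next endpoint decides the arc: compare the least \<open>h\<close> outside
  \<open>Y\<close> with the least \<open>l\<close> outside \<open>X\<close>, a tie going to the left
  endpoint.\<close>

lemma compatible_arc_exists:
  assumes "interval_order S R" "compatible_node R v" "v \<noteq> (S, S)"
  shows "\<exists>a\<in>io_arcs S. fst a = v \<and> compatible_node R (snd a)"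
proof -
  obtain l h :: "'a \<Rightarrow> real" where le: "\<And>i. i \<in> S \<Longrightarrow> l i \<le> h i"
    and R: "\<And>i j. i \<in> S \<Longrightarrow> j \<in> S \<Longrightarrow> (i, j) \<in> R \<longleftrightarrow> h i < l j"
    using assms(1) unfolding interval_order_def by blast
  obtain X Y where v: "v = (X, Y)"
    by fastforce
  have sub: "Y \<subseteq> X" "X \<subseteq> S"
    and in_R: "\<And>i j. i \<in> Y \<Longrightarrow> j \<in> S - X \<Longrightarrow> h i < l j"
    and notin_R: "\<And>i j. i \<in> S - Y \<Longrightarrow> j \<in> X \<Longrightarrow> \<not> h i < l j"
    using assms(2) R by (auto simp: compatible_node_def v io_nodes_def subset_iff)
  have "S - Y \<noteq> {}"
    using assms(3) sub v by auto
  then obtain i where i: "i \<in> S - Y" "\<And>i'. i' \<in> S - Y \<Longrightarrow> h i \<le> h i'"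
    using arg_min_if_finite(1)[of "S - Y" h] arg_min_least[of "S - Y" _ h] finite by blast
  have add_Y: ?thesis if "i \<in> X" "\<And>j. j \<in> S - X \<Longrightarrow> h i < l j"
  proof (intro bexI[of _ "((X, Y), (X, insert i Y))"] conjI)
    show "compatible_node R (snd ((X, Y), (X, insert i Y)))"
      using that i sub in_R notin_R R by (auto simp: compatible_node_def io_nodes_def subset_iff)
    show "((X, Y), (X, insert i Y)) \<in> io_arcs S"
      using that(1) i sub by (auto simp: mem_io_arcs_iff[OF finite])
  qed (simp add: v)
  show ?thesis
  proof (cases "X = S")
    case True
    then show ?thesis
      using add_Y i by auto
  next
    case False
    then have "S - X \<noteq> {}"
      using sub by auto
    then obtain j where j: "j \<in> S - X" "\<And>j'. j' \<in> S - X \<Longrightarrow> l j \<le> l j'"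
      using arg_min_if_finite(1)[of "S - X" l] arg_min_least[of "S - X" _ l] finite by blast
    show ?thesis
    proof (cases "h i < l j")
      case True
      \<comment> \<open>Otherwise \<open>l j \<le> l i \<le> h i\<close> by minimality of
        \<open>j\<close>, contradicting \<open>h i < l j\<close>.\<close>
      have "i \<in> X"
        using True j(2)[of i] le[of i] i(1) by force
      moreover have "h i < l j'" if "j' \<in> S - X" for j'
        using True j(2)[OF that] by simp
      ultimately show ?thesis
        by (rule add_Y)
    next
      case False
      \<comment> \<open>By minimality of \<open>i\<close>, nothing outside \<open>Y\<close> precedes
        \<open>j\<close>, so \<open>j\<close> may enter \<open>X\<close>.\<close>
      have "\<not> h i' < l j" if "i' \<in> S - Y" for i'
        using False i(2)[OF that] by simp
      then have "compatible_node R (insert j X, Y)"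
        using j(1) sub in_R notin_R R by (auto simp: compatible_node_def io_nodes_def subset_iff)
      moreover have "((X, Y), (insert j X, Y)) \<in> io_arcs S"
        using j(1) sub by (auto simp: mem_io_arcs_iff[OF finite])
      ultimately show ?thesis
        using v by (metis fst_conv snd_conv)
    qed
  qed
qed

lemma compatible_walk_exists:
  assumes "interval_order S R" "compatible_node R v"
  shows "\<exists>p. awalk v p (S, S) \<and> (\<forall>a\<in>set p. compatible_node R (fst a) \<and> compatible_node R (snd a))"
  using assms(2)
\<comment> \<open>The measure is the rank still missing to the sink, whose rank is
  \<open>2 * card S\<close>.\<close>
proof (induction "2 * card S - (card (fst v) + card (snd v))" arbitrary: v rule: less_induct)
  case less
  show ?case
  proof (cases "v = (S, S)")
    case True
    then show ?thesis
      using sink by (intro exI[of _ "[]"]) (simp add: awalk_Nil_iff)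
  next
    case False
    obtain a where a: "a \<in> io_arcs S" "fst a = v" "compatible_node R (snd a)"
      using compatible_arc_exists[OF assms(1) less.prems False] by blast
    then have "snd a \<in> io_nodes S"
      by (simp add: compatible_node_def)
    then have "card (fst (snd a)) \<le> card S" "card (snd (snd a)) \<le> card S"
      using finite by (auto simp: io_nodes_def intro!: card_mono)
    moreover have "card (fst v) + card (snd v) < card (fst (snd a)) + card (snd (snd a))"
      using rank_less[of a] a by simp
    ultimately obtain p where "awalk (snd a) p (S, S)"
      "\<forall>b\<in>set p. compatible_node R (fst b) \<and> compatible_node R (snd b)"
      using less.hyps[OF _ a(3)] by force
    then show ?thesis
      using a less.prems by (intro exI[of _ "a # p"]) (simp add: awalk_Cons_iff)
  qed
qed

text \<open>Consider the arc on which \<open>j\<close> enters: compatibility of its tail puts the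
  pairs of the path into \<open>R\<close>, and compatibility of its head gives the converse.\<close>

lemma path_relation_compatible:
  assumes walk: "awalk ({}, {}) p (S, S)" and "R \<subseteq> S \<times> S"
    and compatible: "\<And>a. a \<in> set p \<Longrightarrow> compatible_node R (fst a) \<and> compatible_node R (snd a)"
  shows "path_relation p = R"
proof
  have arcs: "set p \<subseteq> io_arcs S"
    using walk by (auto simp: awalk_def)
  show "path_relation p \<subseteq> R"
  proof clarify
    fix i j assume "(i, j) \<in> path_relation p"
    then obtain a where a: "a \<in> set p" "i \<in> snd (fst a)" "j \<in> fst (snd a)" "j \<notin> fst (fst a)"
      by (auto simp: path_relation_def)
    then have "j \<in> S"
      using arcs io_arc_mono(4) by blast
    then show "(i, j) \<in> R"
      using a compatible[OF a(1)] by (auto simp: compatible_node_def)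
  qed
  show "R \<subseteq> path_relation p"
  proof clarify
    fix i j assume ij: "(i, j) \<in> R"
    then have "i \<in> S" "j \<in> S"
      using assms(2) by auto
    then obtain a where a: "a \<in> set p" "j \<in> fst (snd a) - fst (fst a)"
      using io_walk_enters[OF walk, of j] by auto
    have "i \<in> snd (snd a)"
      using compatible[OF a(1)] a(2) ij \<open>i \<in> S\<close> by (auto simp: compatible_node_def)
    \<comment> \<open>An arc changes only one component, and this one adds \<open>j\<close> to the
      first.\<close>
    moreover have "snd (snd a) = snd (fst a)"
    proof -
      obtain X Y Z T where "a = ((X, Y), (Z, T))"
        by (metis prod.collapse)
      then show ?thesis
        using a arcs by (auto simp: mem_io_arcs_iff[OF finite] subset_iff)
    qed
    ultimately show "(i, j) \<in> path_relation p"
      using a by (auto simp: path_relation_def)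
  qed
qed

text \<open>The generators of the two hulls correspond, although several paths may project to the
  same order.\<close>

lemma io_proj_image_paths:
  "io_proj S ` {indicat_real (set p) | p. apath ({}, {}) p (S, S)} =
    {indicat_real R | R. interval_order S R}"
proof (intro equalityI subsetI)
  fix x assume "x \<in> io_proj S ` {indicat_real (set p) | p. apath ({}, {}) p (S, S)}"
  then obtain p where "awalk ({}, {}) p (S, S)" "x = io_proj S (indicat_real (set p))"
    by (auto simp: apath_def)
  then show "x \<in> {indicat_real R | R. interval_order S R}"
    using io_proj_path interval_order_path_relation by auto
next
  fix x assume "x \<in> {indicat_real R | R. interval_order S R}"
  then obtain R where R: "interval_order S R" "x = indicat_real R"
    by auto
  have "compatible_node R ({}, {})"
    by (simp add: compatible_node_def io_nodes_def)
  then obtain q where q: "awalk ({}, {}) q (S, S)"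
    "\<forall>a\<in>set q. compatible_node R (fst a) \<and> compatible_node R (snd a)"
    using compatible_walk_exists[OF R(1)] by blast
  \<comment> \<open>The flow polytope is generated by simple paths; shortening keeps a subset of the
    arcs, hence compatibility.\<close>
  define p where "p = awalk_to_apath q"
  have p: "apath ({}, {}) p (S, S)" "set p \<subseteq> set q"
    unfolding p_def using q(1) by (rule apath_awalk_to_apath awalk_to_apath_subset)+
  then have walk: "awalk ({}, {}) p (S, S)"
    by (simp add: apath_def)
  have "path_relation p = R"
    using R(1) q(2) p(2) by (intro path_relation_compatible[OF walk]) (auto simp: interval_order_def)
  then have "io_proj S (indicat_real (set p)) = x"
    using io_proj_path[OF walk] R(2) by simp
  then show "x \<in> io_proj S ` {indicat_real (set p) | p. apath ({}, {}) p (S, S)}"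
    using p(1) by auto
qed

lemma io_proj_image_flow_polytope:
  "io_proj S ` flow_polytope (io_network S) ({}, {}) (S, S) = io_polytope S"
  by (simp add: flow_polytope_def io_polytope_def io_proj_image_paths
      convex_hull_linear_image[OF linear_io_proj])

end

section \<open>Size of the extended formulation\<close>

lemma affine_map_io_proj: "affine_map I (off_diag S) (io_proj S)"
  unfolding affine_map_def
proof
  show "io_proj S ` coord_space I \<subseteq> coord_space (off_diag S)"
    by (auto simp: coord_space_def io_proj_def)
  show "\<exists>g c. linear g \<and> (\<forall>x\<in>coord_space I. io_proj S x = g x + c)"
    by (intro exI[of _ "io_proj S"] exI[of _ 0]) (simp add: linear_io_proj)
qed

text \<open>Different arcs give different constraints, so none are merged in the set of
  inequalities.\<close>

lemma description_size_flow_description: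
  "description_size (flow_description D s t) = card (arcs D)"
proof -
  have "inj_on (\<lambda>a. (indicat_real {a}, 0 :: real)) (arcs D)"
    by (auto simp: inj_on_def indicator_def fun_eq_iff split: if_splits)
  then show ?thesis
    by (simp add: description_size_def flow_description_def card_image)
qed

theorem theorem3:
  fixes S :: "'a set" and n :: nat
  assumes "finite S" and "card S = n" and "n \<ge> 1"
  shows "io_proj S ` flow_polytope (io_network S) ({}, {}) (S, S) = io_polytope S \<and>
    linear_description (io_arcs S) (flow_description (io_network S) ({}, {}) (S, S))
      (flow_polytope (io_network S) ({}, {}) (S, S)) \<and>
    extended_formulation (io_arcs S) (flow_description (io_network S) ({}, {}) (S, S))
      (off_diag S) (io_polytope S) \<and>
    description_size (flow_description (io_network S) ({}, {}) (S, S)) = card (io_arcs S) \<and>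
    card (io_arcs S) = 2 * n * 3 ^ (n - 1)"
proof -
  have "S \<noteq> {}"
    using assms by auto
  interpret st_network "io_network S" "({}, {})" "(S, S)" "\<lambda>v. card (fst v) + card (snd v)"
    by (rule st_network_io_network[OF \<open>finite S\<close> \<open>S \<noteq> {}\<close>])
  note image = io_proj_image_flow_polytope[OF \<open>finite S\<close> \<open>S \<noteq> {}\<close>]
  have arcs: "arcs (io_network S) = io_arcs S"
    by (simp add: io_network_def)
  note description = linear_description_flow_polytope[unfolded arcs]
  have "extended_formulation (io_arcs S) (flow_description (io_network S) ({}, {}) (S, S))
      (off_diag S) (io_polytope S)"
    \<comment> \<open>The witnesses are the flow polytope and \<open>io_proj S\<close>.\<close>
    unfolding extended_formulation_def
    using polytope_flow_polytope description affine_map_io_proj image by blast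
  then show ?thesis
    using image description card_io_arcs[OF \<open>finite S\<close>] assms(2)
    by (simp add: description_size_flow_description arcs)
qed

end
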